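(* Let $(X,d)$ be a metric space and let $\mathcal{B}$ be a bornology on $X$ with a closed base. Suppose that the topology $\tau_{ucb}$ on $(C(X),\tau_{\mathcal{B}}^s)^*$ (or on $(C(X),\tau_{\mathcal{B}})^*$) is normable. Then $\mathcal{B}\subseteq\mathcal{K}$.
   Context: $C(X)$ is the real vector space of continuous functions $X\to\mathbb{R}$. A bornology $\mathcal{B}$ on $X$ is a collection of non-empty subsets of $X$ that covers $X$ and is closed under finite unions and under taking (non-empty) subsets of its members; it has a closed base if every member of $\mathcal{B}$ is contained in a closed member of $\mathcal{B}$. $\mathcal{K}$ is the bornology of all non-empty relatively compact subsets of $X$. For $B\subseteq X$ and $\delta>0$, $B^\delta=\bigcup_{y\in B}\{x\in X:d(x,y)<\delta\}$. For $B\in\mathcal{B}$ let $\rho_B(f)=\sup_{x\in B}|f(x)|\in[0,\infty]$ and $\rho_B^s(f)=\inf_{\delta>0}\sup_{x\in B^\delta}|f(x)|\in[0,\infty]$. $\tau_{\mathcal{B}}$, respectively $\tau_{\mathcal{B}}^s$, is the translation-invariant topology on $C(X)$ for which the sets $\rho_B^{-1}([0,r))$, respectively $(\rho_B^s)^{-1}([0,r))$ ($B\in\mathcal{B}$, $r>0$), form a neighborhood base at $0$. A superscript $*$ denotes the space of all continuous linear functionals into $\mathbb{R}$. Both spaces are extended locally convex spaces, i.e. vector spaces $Z$ whose topology $\tau$ is induced by a family of extended seminorms (functions with the properties of a seminorm that may take the value $\infty$). A subset $A$ of such $(Z,\tau)$ is bounded if for every neighborhood $U$ of $0$ there exist $r>0$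 and a finite set $E\subseteq Z$ with $A\subseteq E+rU$. $\tau_{ucb}$ is the locally convex topology on $Z^*$ induced by the seminorms $F\mapsto\sup_{x\in A}|F(x)|$, $A$ ranging over the bounded subsets of $(Z,\tau)$. A topology on a vector space is normable if it is induced by a norm. *)

theory Defs
  imports "HOL-Analysis.Analysis" "HOL-Library.Function_Algebras"
begin

instantiation "fun" :: (type, real_vector) real_vector
begin

definition scaleR_fun :: "real \<Rightarrow> ('a \<Rightarrow> 'b) \<Rightarrow> 'a \<Rightarrow> 'b"
  where "scaleR_fun c f = (\<lambda>x. c *\<^sub>R f x)"

instance
  by standard (simp_all add: scaleR_fun_def fun_eq_iff algebra_simps)

end

lemma scaleR_fun_apply [simp]: "(c *\<^sub>R f) x = c *\<^sub>R f x"
  by (simp add: scaleR_fun_def)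


section \<open>Translation-invariant topologies on subspaces of a real vector space\<close>

text \<open>The translation-invariant topology on the subspace \<open>V\<close> that has \<open>\<N>\<close> as a neighborhood
  base at \<open>0\<close>. The predicate \<open>zero_nhd_base\<close> collects the conditions under which \<open>\<N>\<close> really is
  one (lemma \<open>transl_topology_nhd_iff\<close>); all instances below satisfy them.\<close>

definition transl_topology :: "'v::real_vector set \<Rightarrow> 'v set set \<Rightarrow> 'v topology"
  where "transl_topology V \<N> =
    topology (\<lambda>U. U \<subseteq> V \<and> (\<forall>f\<in>U. \<exists>W\<in>\<N>. (\<lambda>h. f + h) ` W \<subseteq> U))"

definition zero_nhd_base :: "'v::real_vector set \<Rightarrow> 'v set set \<Rightarrow> bool"
  where "zero_nhd_base V \<N> \<longleftrightarrow> subspace V \<and> \<N> \<noteq> {} \<and>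
    (\<forall>W\<in>\<N>. 0 \<in> W \<and> W \<subseteq> V) \<and>
    (\<forall>W1\<in>\<N>. \<forall>W2\<in>\<N>. \<exists>W\<in>\<N>. W \<subseteq> W1 \<inter> W2) \<and>
    (\<forall>W\<in>\<N>. \<exists>W'\<in>\<N>. \<forall>x\<in>W'. \<forall>y\<in>W'. x + y \<in> W)"

lemma
  assumes "zero_nhd_base V \<N>"
  shows zero_nhd_base_subspace: "subspace V"
    and zero_nhd_base_nonempty: "\<N> \<noteq> {}"
    and zero_nhd_base_zero: "W \<in> \<N> \<Longrightarrow> 0 \<in> W"
    and zero_nhd_base_subset: "W \<in> \<N> \<Longrightarrow> W \<subseteq> V"
    and zero_nhd_base_inter: "W1 \<in> \<N> \<Longrightarrow> W2 \<in> \<N> \<Longrightarrow> \<exists>W\<in>\<N>. W \<subseteq> W1 \<inter> W2"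
    and zero_nhd_base_add: "W \<in> \<N> \<Longrightarrow> \<exists>W'\<in>\<N>. \<forall>x\<in>W'. \<forall>y\<in>W'. x + y \<in> W"
  using assms unfolding zero_nhd_base_def by (elim conjE; simp)+

lemma openin_transl_topology:
  assumes "zero_nhd_base V \<N>"
  shows "openin (transl_topology V \<N>) U \<longleftrightarrow>
    U \<subseteq> V \<and> (\<forall>f\<in>U. \<exists>W\<in>\<N>. (\<lambda>h. f + h) ` W \<subseteq> U)"
proof -
  let ?P = "\<lambda>U. U \<subseteq> V \<and> (\<forall>f\<in>U. \<exists>W\<in>\<N>. (\<lambda>h. f + h) ` W \<subseteq> U)"
  have "istopology ?P"
    unfolding istopology_def
  proof (intro conjI allI impI)
    fix S T assume S: "?P S" and T: "?P T"
    show "S \<inter> T \<subseteq> V" using S by blast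
    show "\<forall>f\<in>S \<inter> T. \<exists>W\<in>\<N>. (\<lambda>h. f + h) ` W \<subseteq> S \<inter> T"
    proof
      fix f assume f: "f \<in> S \<inter> T"
      obtain W1 where W1: "W1 \<in> \<N>" "(\<lambda>h. f + h) ` W1 \<subseteq> S" using S f by blast
      obtain W2 where W2: "W2 \<in> \<N>" "(\<lambda>h. f + h) ` W2 \<subseteq> T" using T f by blast
      obtain W where "W \<in> \<N>" "W \<subseteq> W1 \<inter> W2"
        using zero_nhd_base_inter[OF assms W1(1) W2(1)] by blast
      then show "\<exists>W\<in>\<N>. (\<lambda>h. f + h) ` W \<subseteq> S \<inter> T" using W1(2) W2(2) by blast
    qed
  next
    fix \<K> assume K: "\<forall>K\<in>\<K>. ?P K"
    then show "\<Union>\<K> \<subseteq> V" by blast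
    show "\<forall>f\<in>\<Union>\<K>. \<exists>W\<in>\<N>. (\<lambda>h. f + h) ` W \<subseteq> \<Union>\<K>"
      using K by (meson Sup_upper UnionE order_trans)
  qed
  then show ?thesis by (simp add: transl_topology_def topology_inverse')
qed

lemma topspace_transl_topology:
  assumes "zero_nhd_base V \<N>"
  shows "topspace (transl_topology V \<N>) = V"
proof
  have "openin (transl_topology V \<N>) (topspace (transl_topology V \<N>))"
    by (rule openin_topspace)
  then show "topspace (transl_topology V \<N>) \<subseteq> V"
    unfolding openin_transl_topology[OF assms] by (rule conjunct1)
  obtain W where W: "W \<in> \<N>" "W \<subseteq> V"
    using zero_nhd_base_nonempty[OF assms] zero_nhd_base_subset[OF assms] by blast
  note V = zero_nhd_base_subspace[OF assms]
  have "(\<lambda>h. f + h) ` W \<subseteq> V" if "f \<in> V" for f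
  proof (rule image_subsetI)
    fix h assume "h \<in> W"
    then have "h \<in> V" using W(2) by blast
    with that show "f + h \<in> V" by (rule subspace_add[OF V])
  qed
  then have "openin (transl_topology V \<N>) V"
    unfolding openin_transl_topology[OF assms] using W(1) by (intro conjI order_refl ballI bexI)
  then show "V \<subseteq> topspace (transl_topology V \<N>)" by (rule openin_subset)
qed

lemma transl_topology_nhd_iff:
  assumes "zero_nhd_base V \<N>" "f \<in> V" "S \<subseteq> V"
  shows "(\<exists>U. openin (transl_topology V \<N>) U \<and> f \<in> U \<and> U \<subseteq> S) \<longleftrightarrow>
    (\<exists>W\<in>\<N>. (\<lambda>h. f + h) ` W \<subseteq> S)"
proof
  assume "\<exists>U. openin (transl_topology V \<N>) U \<and> f \<in> U \<and> U \<subseteq> S"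
  then obtain U where "openin (transl_topology V \<N>) U" "f \<in> U" "U \<subseteq> S" by blast
  then obtain W where "W \<in> \<N>" "(\<lambda>h. f + h) ` W \<subseteq> U"
    unfolding openin_transl_topology[OF assms(1)] by blast
  then show "\<exists>W\<in>\<N>. (\<lambda>h. f + h) ` W \<subseteq> S" using \<open>U \<subseteq> S\<close> by (meson order_trans)
next
  assume f: "\<exists>W\<in>\<N>. (\<lambda>h. f + h) ` W \<subseteq> S"
  define U where "U = {g \<in> V. \<exists>W\<in>\<N>. (\<lambda>h. g + h) ` W \<subseteq> S}"
  note V = zero_nhd_base_subspace[OF assms(1)]
  have "U \<subseteq> S"
  proof
    fix g assume "g \<in> U"
    then obtain W where W: "W \<in> \<N>" "(\<lambda>h. g + h) ` W \<subseteq> S" unfolding U_def by blast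
    have "g + 0 \<in> S" using W(2) zero_nhd_base_zero[OF assms(1) W(1)] by (rule subsetD[OF _ imageI])
    then show "g \<in> S" by simp
  qed
  moreover have "openin (transl_topology V \<N>) U"
    unfolding openin_transl_topology[OF assms(1)]
  proof (intro conjI ballI)
    show "U \<subseteq> V" unfolding U_def by blast
    fix g assume "g \<in> U"
    then obtain W where W: "W \<in> \<N>" "(\<lambda>h. g + h) ` W \<subseteq> S" "g \<in> V" unfolding U_def by blast
    obtain W' where W': "W' \<in> \<N>" "\<forall>x\<in>W'. \<forall>y\<in>W'. x + y \<in> W"
      using zero_nhd_base_add[OF assms(1) W(1)] by blast
    have "W' \<subseteq> V" by (rule zero_nhd_base_subset[OF assms(1) W'(1)])
    have "g + h \<in> U" if "h \<in> W'" for h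
    proof -
      have "h \<in> V" using \<open>W' \<subseteq> V\<close> that by blast
      with W(3) have "g + h \<in> V" by (rule subspace_add[OF V])
      moreover have "(g + h) + k \<in> S" if "k \<in> W'" for k
        using W(2) W'(2) \<open>h \<in> W'\<close> that by (simp add: add.assoc image_subset_iff)
      ultimately show ?thesis unfolding U_def using W'(1) by blast
    qed
    then show "\<exists>W\<in>\<N>. (\<lambda>h. g + h) ` W \<subseteq> U" using W'(1) by (intro bexI image_subsetI)
  qed
  moreover have "f \<in> U" unfolding U_def using f assms(2) by blast
  ultimately show "\<exists>U. openin (transl_topology V \<N>) U \<and> f \<in> U \<and> U \<subseteq> S" by blast
qed

definition seminorm_topology :: "'v::real_vector set \<Rightarrow> ('v \<Rightarrow> ennreal) set \<Rightarrow> 'v topology"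
  where "seminorm_topology V P = transl_topology V
    {{x \<in> V. \<forall>p\<in>Q. p x < ennreal r} | Q r. finite Q \<and> Q \<subseteq> P \<and> 0 < r}"

lemma zero_nhd_base_seminorms:
  assumes "subspace V"
    and zero: "\<And>p. p \<in> P \<Longrightarrow> p 0 = 0"
    and add: "\<And>p x y. p \<in> P \<Longrightarrow> x \<in> V \<Longrightarrow> y \<in> V \<Longrightarrow> p (x + y) \<le> p x + p y"
  shows "zero_nhd_base V {{x \<in> V. \<forall>p\<in>Q. p x < ennreal r} | Q r. finite Q \<and> Q \<subseteq> P \<and> 0 < r}"
    (is "zero_nhd_base V ?N")
  unfolding zero_nhd_base_def
proof (intro conjI ballI)
  show "subspace V" by fact
  have "{x \<in> V. \<forall>p\<in>{}. p x < ennreal 1} \<in> ?N"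
    by (intro CollectI exI[of _ "{}"] exI[of _ 1]) auto
  then show "?N \<noteq> {}" by blast
next
  fix W assume "W \<in> ?N"
  then obtain Q r where W: "W = {x \<in> V. \<forall>p\<in>Q. p x < ennreal r}" "finite Q" "Q \<subseteq> P" "0 < r"
    by blast
  show "0 \<in> W"
  proof -
    have "p 0 < ennreal r" if "p \<in> Q" for p
    proof -
      have "p 0 = 0" using that W(3) zero by blast
      then show ?thesis using W(4) by simp
    qed
    then show ?thesis unfolding W(1) using subspace_0[OF assms(1)] by blast
  qed
  show "W \<subseteq> V" using W by blast
  let ?W = "{x \<in> V. \<forall>p\<in>Q. p x < ennreal (r / 2)}"
  have "?W \<in> ?N" using W by (intro CollectI exI[of _ Q] exI[of _ "r / 2"]) auto
  moreover have "x + y \<in> W" if "x \<in> ?W" "y \<in> ?W" for x y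
  proof -
    have "p (x + y) < ennreal r" if "p \<in> Q" for p
    proof -
      have "p (x + y) \<le> p x + p y" using that \<open>x \<in> ?W\<close> \<open>y \<in> ?W\<close> W(3) add by blast
      also have "\<dots> < ennreal (r / 2) + ennreal (r / 2)"
        using that \<open>x \<in> ?W\<close> \<open>y \<in> ?W\<close> by (intro add_strict_mono) auto
      also have "\<dots> = ennreal r" using W(4) by (simp flip: ennreal_plus)
      finally show ?thesis .
    qed
    moreover have "x + y \<in> V" using that subspace_add[OF assms(1), of x y] by simp
    ultimately show ?thesis unfolding W(1) by simp
  qed
  ultimately show "\<exists>W'\<in>?N. \<forall>x\<in>W'. \<forall>y\<in>W'. x + y \<in> W" by blast
next
  fix W1 W2 assume "W1 \<in> ?N" "W2 \<in> ?N"
  then obtain Q1 r1 Q2 r2 where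
    W1: "W1 = {x \<in> V. \<forall>p\<in>Q1. p x < ennreal r1}" "finite Q1" "Q1 \<subseteq> P" "0 < r1" and
    W2: "W2 = {x \<in> V. \<forall>p\<in>Q2. p x < ennreal r2}" "finite Q2" "Q2 \<subseteq> P" "0 < r2" by blast
  let ?W = "{x \<in> V. \<forall>p\<in>Q1 \<union> Q2. p x < ennreal (min r1 r2)}"
  have "?W \<in> ?N" using W1 W2 by (intro CollectI exI[of _ "Q1 \<union> Q2"] exI[of _ "min r1 r2"]) auto
  moreover have "ennreal (min r1 r2) \<le> ennreal r1" "ennreal (min r1 r2) \<le> ennreal r2"
    by (simp_all add: ennreal_leI)
  then have "?W \<subseteq> W1 \<inter> W2" unfolding W1(1) W2(1) by (auto intro: order.strict_trans2)
  ultimately show "\<exists>W\<in>?N. W \<subseteq> W1 \<inter> W2" by blast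
qed


section \<open>Normability, bounded sets and the dual with \<open>\<tau>\<^sub>u\<^sub>c\<^sub>b\<close>\<close>

text \<open>Below, \<open>T\<close> is a topology whose underlying set \<open>topspace T\<close> is a subspace of \<open>'v\<close>.\<close>

definition norm_on :: "'v::real_vector set \<Rightarrow> ('v \<Rightarrow> real) \<Rightarrow> bool"
  where "norm_on V n \<longleftrightarrow>
    (\<forall>x\<in>V. 0 \<le> n x) \<and>
    (\<forall>x\<in>V. n x = 0 \<longleftrightarrow> x = 0) \<and>
    (\<forall>c. \<forall>x\<in>V. n (c *\<^sub>R x) = \<bar>c\<bar> * n x) \<and>
    (\<forall>x\<in>V. \<forall>y\<in>V. n (x + y) \<le> n x + n y)"

definition normable :: "'v::real_vector topology \<Rightarrow> bool"
  where "normable T \<longleftrightarrow>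
    (\<exists>n. norm_on (topspace T) n \<and> T = seminorm_topology (topspace T) {\<lambda>x. ennreal (n x)})"

definition tvs_bounded :: "'v::real_vector topology \<Rightarrow> 'v set \<Rightarrow> bool"
  where "tvs_bounded T A \<longleftrightarrow> A \<subseteq> topspace T \<and>
    (\<forall>U. U \<subseteq> topspace T \<and> (\<exists>O'. openin T O' \<and> 0 \<in> O' \<and> O' \<subseteq> U) \<longrightarrow>
      (\<exists>r>0. \<exists>E. finite E \<and> E \<subseteq> topspace T \<and> A \<subseteq> {e + r *\<^sub>R u | e u. e \<in> E \<and> u \<in> U}))"

text \<open>Functionals on \<open>topspace T\<close> are represented by total functions that vanish outside
  \<open>topspace T\<close>, so that the dual is a subspace of \<open>'v \<Rightarrow> real\<close> with pointwise operations.\<close>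

definition dual_space :: "'v::real_vector topology \<Rightarrow> ('v \<Rightarrow> real) set"
  where "dual_space T = {F.
    (\<forall>x. x \<notin> topspace T \<longrightarrow> F x = 0) \<and>
    (\<forall>x\<in>topspace T. \<forall>y\<in>topspace T. F (x + y) = F x + F y) \<and>
    (\<forall>c. \<forall>x\<in>topspace T. F (c *\<^sub>R x) = c * F x) \<and>
    continuous_map T euclideanreal F}"

definition tau_ucb :: "'v::real_vector topology \<Rightarrow> ('v \<Rightarrow> real) topology"
  where "tau_ucb T = seminorm_topology (dual_space T)
    {(\<lambda>F. SUP x\<in>A. ennreal \<bar>F x\<bar>) | A. tvs_bounded T A}"

lemma subspace_dual_space:
  assumes "subspace (topspace T)"
  shows "subspace (dual_space T)"
proof (rule subspaceI)
  show "0 \<in> dual_space T" by (simp add: dual_space_def zero_fun_def)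
next
  fix F G assume F: "F \<in> dual_space T" and G: "G \<in> dual_space T"
  have "continuous_map T euclideanreal (\<lambda>x. F x + G x)"
    using F G by (intro continuous_map_add) (auto simp: dual_space_def)
  then show "F + G \<in> dual_space T"
    using F G by (simp add: dual_space_def plus_fun_def algebra_simps)
next
  fix c :: real and F assume F: "F \<in> dual_space T"
  have "continuous_map T euclideanreal (\<lambda>x. c * F x)"
    using F by (intro continuous_map_real_mult_left) (auto simp: dual_space_def)
  then show "c *\<^sub>R F \<in> dual_space T"
    using F by (simp add: dual_space_def scaleR_fun_def algebra_simps)
qed

lemma SUP_abs_0: "(SUP x\<in>A. ennreal \<bar>(0 :: 'a \<Rightarrow> real) x\<bar>) = 0"
  by (cases "A = {}") (simp_all add: bot_ennreal)

lemma SUP_abs_add_le: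
  fixes f g :: "'a \<Rightarrow> real"
  shows "(SUP x\<in>A. ennreal \<bar>(f + g) x\<bar>) \<le> (SUP x\<in>A. ennreal \<bar>f x\<bar>) + (SUP x\<in>A. ennreal \<bar>g x\<bar>)"
proof (rule SUP_least)
  fix x assume x: "x \<in> A"
  have "ennreal \<bar>(f + g) x\<bar> \<le> ennreal \<bar>f x\<bar> + ennreal \<bar>g x\<bar>"
    by (simp add: abs_triangle_ineq ennreal_leI flip: ennreal_plus)
  also have "\<dots> \<le> (SUP x\<in>A. ennreal \<bar>f x\<bar>) + (SUP x\<in>A. ennreal \<bar>g x\<bar>)"
    using x by (intro add_mono SUP_upper)
  finally show "ennreal \<bar>(f + g) x\<bar> \<le> \<dots>" .
qed

lemma topspace_tau_ucb:
  assumes "subspace (topspace T)"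
  shows "topspace (tau_ucb T) = dual_space T"
  unfolding tau_ucb_def seminorm_topology_def
proof (intro topspace_transl_topology zero_nhd_base_seminorms subspace_dual_space assms)
  fix p assume "p \<in> {(\<lambda>F :: 'a \<Rightarrow> real. SUP x\<in>A. ennreal \<bar>F x\<bar>) | A. tvs_bounded T A}"
  then obtain A where p: "p = (\<lambda>F. SUP x\<in>A. ennreal \<bar>F x\<bar>)" by blast
  show "p 0 = 0" unfolding p by (rule SUP_abs_0)
  show "p (F + G) \<le> p F + p G" for F G unfolding p by (rule SUP_abs_add_le)
qed


section \<open>Bornologies and the topologies on \<open>C(X)\<close>\<close>

definition bornology :: "'a set set \<Rightarrow> bool"
  where "bornology \<B> \<longleftrightarrow> {} \<notin> \<B> \<and> \<Union>\<B> = UNIV \<and>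
    (\<forall>A\<in>\<B>. \<forall>B\<in>\<B>. A \<union> B \<in> \<B>) \<and>
    (\<forall>B\<in>\<B>. \<forall>A. A \<noteq> {} \<and> A \<subseteq> B \<longrightarrow> A \<in> \<B>)"

definition has_closed_base :: "'a::topological_space set set \<Rightarrow> bool"
  where "has_closed_base \<B> \<longleftrightarrow> (\<forall>B\<in>\<B>. \<exists>C\<in>\<B>. closed C \<and> B \<subseteq> C)"

definition relatively_compact_sets :: "'a::topological_space set set"
  where "relatively_compact_sets = {A. A \<noteq> {} \<and> compact (closure A)}"

definition C_space :: "('a::topological_space \<Rightarrow> real) set"
  where "C_space = {f. continuous_on UNIV f}"

definition enlargement :: "'a::metric_space set \<Rightarrow> real \<Rightarrow> 'a set"
  where "enlargement B \<delta> = (\<Union>y\<in>B. {x. dist x y < \<delta>})"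

definition rho :: "'a set \<Rightarrow> ('a \<Rightarrow> real) \<Rightarrow> ennreal"
  where "rho B f = (SUP x\<in>B. ennreal \<bar>f x\<bar>)"

definition rho_s :: "'a::metric_space set \<Rightarrow> ('a \<Rightarrow> real) \<Rightarrow> ennreal"
  where "rho_s B f = (INF \<delta>\<in>{0<..}. SUP x\<in>enlargement B \<delta>. ennreal \<bar>f x\<bar>)"

definition tau :: "'a::metric_space set set \<Rightarrow> ('a \<Rightarrow> real) topology"
  where "tau \<B> = transl_topology C_space
    {{f \<in> C_space. rho B f < ennreal r} | B r. B \<in> \<B> \<and> 0 < r}"

definition tau_s :: "'a::metric_space set set \<Rightarrow> ('a \<Rightarrow> real) topology"
  where "tau_s \<B> = transl_topology C_space
    {{f \<in> C_space. rho_s B f < ennreal r} | B r. B \<in> \<B> \<and> 0 < r}"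

lemma subspace_C_space: "subspace C_space"
proof (rule subspaceI)
  show "0 \<in> C_space"
    unfolding C_space_def zero_fun_def by (rule CollectI, rule continuous_on_const)
next
  fix f g :: "'a \<Rightarrow> real" assume "f \<in> C_space" "g \<in> C_space"
  then show "f + g \<in> C_space"
    unfolding C_space_def plus_fun_def mem_Collect_eq by (rule continuous_on_add)
next
  fix c :: real and f :: "'a \<Rightarrow> real" assume "f \<in> C_space"
  then show "c *\<^sub>R f \<in> C_space"
    unfolding C_space_def scaleR_fun_def mem_Collect_eq
    by (rule continuous_on_scaleR[OF continuous_on_const])
qed

lemma enlargement_mono:
  assumes "A \<subseteq> B" "\<delta> \<le> \<epsilon>"
  shows "enlargement A \<delta> \<subseteq> enlargement B \<epsilon>"
proof
  fix x assume "x \<in> enlargement A \<delta>"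
  then obtain y where "y \<in> A" "dist x y < \<delta>" unfolding enlargement_def by blast
  then have "y \<in> B" "dist x y < \<epsilon>" using assms by auto
  then show "x \<in> enlargement B \<epsilon>" unfolding enlargement_def by blast
qed

lemma rho_mono: "A \<subseteq> B \<Longrightarrow> rho A f \<le> rho B f"
  unfolding rho_def by (rule SUP_subset_mono) auto

lemma rho_s_eq: "rho_s B f = (INF \<delta>\<in>{0<..}. rho (enlargement B \<delta>) f)"
  by (simp add: rho_s_def rho_def)

lemma rho_s_mono: "A \<subseteq> B \<Longrightarrow> rho_s A f \<le> rho_s B f"
  unfolding rho_s_eq
  by (rule INF_mono) (meson enlargement_mono order_refl rho_mono)

lemma rho_0: "rho B 0 = 0"
  unfolding rho_def by (rule SUP_abs_0)

lemma rho_s_0: "rho_s B 0 = 0"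
  by (simp add: rho_s_eq rho_0)

lemma rho_add_le: "rho B (f + g) \<le> rho B f + rho B g"
  unfolding rho_def by (rule SUP_abs_add_le)

lemma rho_s_add_le: "rho_s B (f + g) \<le> rho_s B f + rho_s B g"
proof -
  have "rho_s B (f + g) \<le> rho (enlargement B \<delta>) f + rho (enlargement B \<epsilon>) g"
    if "\<delta> > 0" "\<epsilon> > 0" for \<delta> \<epsilon>
  proof -
    have "rho_s B (f + g) \<le> rho (enlargement B (min \<delta> \<epsilon>)) (f + g)"
      unfolding rho_s_eq using that by (intro INF_lower) auto
    also have "\<dots> \<le> rho (enlargement B (min \<delta> \<epsilon>)) f + rho (enlargement B (min \<delta> \<epsilon>)) g"
      by (rule rho_add_le)
    also have "\<dots> \<le> rho (enlargement B \<delta>) f + rho (enlargement B \<epsilon>) g"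
      by (intro add_mono rho_mono enlargement_mono) auto
    finally show ?thesis .
  qed
  note le = this
  show ?thesis
  proof (rule ennreal_le_epsilon)
    fix e :: real assume fin: "rho_s B f + rho_s B g < top" and e: "0 < e"
    have less: "x < x + ennreal (e / 2)" if "x < top" for x
      using that e ennreal_add_left_cancel_less[of x 0 "ennreal (e / 2)"] by simp
    have f: "rho_s B f < rho_s B f + ennreal (e / 2)" and g: "rho_s B g < rho_s B g + ennreal (e / 2)"
      using fin by (simp_all only: less ennreal_add_less_top)
    obtain \<delta> where \<delta>: "\<delta> > 0" "rho (enlargement B \<delta>) f < rho_s B f + ennreal (e / 2)"
      using f unfolding rho_s_eq[of B f] INF_less_iff by auto
    obtain \<epsilon> where \<epsilon>: "\<epsilon> > 0" "rho (enlargement B \<epsilon>) g < rho_s B g + ennreal (e / 2)"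
      using g unfolding rho_s_eq[of B g] INF_less_iff by auto
    have "rho_s B (f + g) \<le> (rho_s B f + ennreal (e / 2)) + (rho_s B g + ennreal (e / 2))"
      using le[OF \<delta>(1) \<epsilon>(1)] add_mono[OF less_imp_le[OF \<delta>(2)] less_imp_le[OF \<epsilon>(2)]]
      by (rule order_trans)
    also have "\<dots> = rho_s B f + rho_s B g + (ennreal (e / 2) + ennreal (e / 2))"
      by (simp only: ac_simps)
    also have "ennreal (e / 2) + ennreal (e / 2) = ennreal e"
      using e by (simp flip: ennreal_plus)
    finally show "rho_s B (f + g) \<le> rho_s B f + rho_s B g + ennreal e" .
  qed
qed

lemma zero_nhd_base_of_directed:
  fixes \<rho> :: "'a::topological_space set \<Rightarrow> ('a \<Rightarrow> real) \<Rightarrow> ennreal"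
  assumes "bornology \<B>"
    and mono: "\<And>A B f. A \<subseteq> B \<Longrightarrow> \<rho> A f \<le> \<rho> B f"
    and zero: "\<And>B. \<rho> B 0 = 0"
    and add: "\<And>B f g. \<rho> B (f + g) \<le> \<rho> B f + \<rho> B g"
  shows "zero_nhd_base C_space {{f \<in> C_space. \<rho> B f < ennreal r} | B r. B \<in> \<B> \<and> 0 < r}"
    (is "zero_nhd_base _ ?N")
  unfolding zero_nhd_base_def
proof (intro conjI ballI)
  show "subspace (C_space :: ('a \<Rightarrow> real) set)" by (rule subspace_C_space)
  have "\<Union>\<B> = UNIV" using assms(1) by (simp add: bornology_def)
  then obtain B where "B \<in> \<B>" by (metis UNIV_I UnionE)
  then have "{f \<in> C_space. \<rho> B f < ennreal 1} \<in> ?N"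
    by (intro CollectI exI[of _ B] exI[of _ 1]) simp
  then show "?N \<noteq> {}" by blast
next
  fix W assume "W \<in> ?N"
  then obtain B r where W: "W = {f \<in> C_space. \<rho> B f < ennreal r}" "B \<in> \<B>" "0 < r"
    by blast
  show "0 \<in> W" unfolding W(1) using W(3) zero subspace_0[OF subspace_C_space] by simp
  show "W \<subseteq> C_space" using W by blast
  let ?W = "{f \<in> C_space. \<rho> B f < ennreal (r / 2)}"
  have "?W \<in> ?N" using W(2,3) by (intro CollectI exI[of _ B] exI[of _ "r / 2"]) simp
  moreover have "f + g \<in> W" if "f \<in> ?W" "g \<in> ?W" for f g
  proof -
    have "\<rho> B (f + g) \<le> \<rho> B f + \<rho> B g" by (rule add)
    also have "\<dots> < ennreal (r / 2) + ennreal (r / 2)"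
      using that by (intro add_strict_mono) simp_all
    also have "\<dots> = ennreal r" using W(3) by (simp flip: ennreal_plus)
    finally have "\<rho> B (f + g) < ennreal r" .
    moreover have "f + g \<in> C_space" using that subspace_add[OF subspace_C_space, of f g] by simp
    ultimately show ?thesis unfolding W(1) by simp
  qed
  ultimately show "\<exists>W'\<in>?N. \<forall>x\<in>W'. \<forall>y\<in>W'. x + y \<in> W" by blast
next
  fix W1 W2 assume "W1 \<in> ?N" "W2 \<in> ?N"
  then obtain B1 r1 B2 r2 where
    W1: "W1 = {f \<in> C_space. \<rho> B1 f < ennreal r1}" "B1 \<in> \<B>" "0 < r1" and
    W2: "W2 = {f \<in> C_space. \<rho> B2 f < ennreal r2}" "B2 \<in> \<B>" "0 < r2" by blast
  let ?W = "{f \<in> C_space. \<rho> (B1 \<union> B2) f < ennreal (min r1 r2)}"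
  have "B1 \<union> B2 \<in> \<B>" using assms(1) W1(2) W2(2) by (simp add: bornology_def)
  then have "?W \<in> ?N"
    using W1(3) W2(3)
    by (intro CollectI exI[of _ "B1 \<union> B2"] exI[of _ "min r1 r2"]) simp
  moreover have "?W \<subseteq> W1 \<inter> W2"
  proof
    fix f assume f: "f \<in> ?W"
    then have less: "\<rho> (B1 \<union> B2) f < ennreal (min r1 r2)" by simp
    have "\<rho> B1 f < ennreal r1"
      by (rule order.strict_trans1[OF mono[OF Un_upper1] order.strict_trans2[OF less]])
        (simp add: ennreal_leI)
    moreover have "\<rho> B2 f < ennreal r2"
      by (rule order.strict_trans1[OF mono[OF Un_upper2] order.strict_trans2[OF less]])
        (simp add: ennreal_leI)
    ultimately show "f \<in> W1 \<inter> W2" unfolding W1(1) W2(1) using f by simp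
  qed
  ultimately show "\<exists>W\<in>?N. W \<subseteq> W1 \<inter> W2" by blast
qed

lemma zero_nhd_base_tau:
  "bornology \<B> \<Longrightarrow> zero_nhd_base C_space {{f \<in> C_space. rho B f < ennreal r} | B r. B \<in> \<B> \<and> 0 < r}"
  by (rule zero_nhd_base_of_directed[OF _ rho_mono rho_0 rho_add_le])

lemma zero_nhd_base_tau_s:
  "bornology \<B> \<Longrightarrow> zero_nhd_base C_space {{f \<in> C_space. rho_s B f < ennreal r} | B r. B \<in> \<B> \<and> 0 < r}"
  by (rule zero_nhd_base_of_directed[OF _ rho_s_mono rho_s_0 rho_s_add_le])

lemma topspace_tau: "bornology \<B> \<Longrightarrow> topspace (tau \<B>) = C_space"
  unfolding tau_def by (rule topspace_transl_topology[OF zero_nhd_base_tau])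

lemma topspace_tau_s: "bornology \<B> \<Longrightarrow> topspace (tau_s \<B>) = C_space"
  unfolding tau_s_def by (rule topspace_transl_topology[OF zero_nhd_base_tau_s])

end

theory Submission
  imports Defs
begin

text \<open>
  Suppose that \<open>\<B>\<close> has a member that is not relatively compact, and let \<open>C \<in> \<B>\<close> be closed and
  contain it. Then \<open>C\<close> is not compact, so some continuous function on the whole space is unbounded
  on \<open>C\<close> (\<open>exists_continuous_unbounded_on_closed_noncompact\<close>). The functions that are bounded on \<open>C\<close>
  therefore form a proper subspace \<open>Y\<close> of \<open>C(X)\<close>. It is open in both topologies, because it contains
  the unit balls of \<open>\<rho>\<^sub>C\<close> and of \<open>\<rho>\<^sub>C\<^sup>s\<close>.

  Since \<open>Y\<close> is open, every linear functional that vanishes on \<open>Y\<close> is continuous. The dual thus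
  contains the full algebraic dual of \<open>C(X) / Y\<close>. On this part \<open>\<tau>\<^sub>u\<^sub>c\<^sub>b\<close> is only the weak-star
  topology: a bounded set lies in \<open>E + r Y = E + Y\<close> with \<open>E\<close> finite, so its image in the quotient is
  finite. The weak-star topology on the algebraic dual of an infinite-dimensional space is not
  normable, because finitely many evaluations never control a functional; this is
  \<open>not_normable_tau_ucb\<close>. The quotient \<open>C(X) / Y\<close> does have infinite dimension: finitely many
  functions cannot dominate all continuous functions on \<open>C\<close>, see \<open>finite_extension_of_bounded_functions\<close>.
\<close>

section \<open>Open subspaces of infinite codimension\<close>

lemma exists_linear_functional_separating_subspace:
  fixes S :: "'v::real_vector set"
  assumes "subspace S" "g \<notin> S"
  obtains \<phi> :: "'v \<Rightarrow> real" where "linear \<phi>" "\<And>x. x \<in> S \<Longrightarrow> \<phi> x = 0" "\<phi> g = 1"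
proof -
  obtain D where D: "D \<subseteq> S" "independent D" "S \<subseteq> span D"
    by (rule maximal_independent_subset)
  have "span D = S"
    using D span_minimal[OF D(1) assms(1)] by blast
  then have "independent (insert g D)"
    using D(2) assms(2) by (simp add: independent_insert)
  then obtain \<phi> :: "'v \<Rightarrow> real"
    where \<phi>: "linear \<phi>" "\<forall>x\<in>insert g D. \<phi> x = (if x = g then 1 else 0)"
    using linear_independent_extend[of "insert g D" "\<lambda>x. if x = g then 1 else 0"] by auto
  have "\<phi> x = 0" if "x \<in> D" for x
    using \<phi>(2) that D(1) assms(2) by auto
  then have "\<phi> x = 0" if "x \<in> S" for x
    using linear_eq_0_on_span[OF \<phi>(1), of D x] that \<open>span D = S\<close> by simp
  then show thesis
    using that[of \<phi>] \<phi> by simp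
qed

text \<open>Such a functional is locally constant, since it is constant on the cosets of the open
  subspace \<open>Y\<close>.\<close>

lemma linear_vanishing_on_open_subspace_in_dual:
  fixes V :: "'v::real_vector set"
  assumes base: "zero_nhd_base V \<N>"
    and W: "W \<in> \<N>" "W \<subseteq> Y"
    and \<phi>: "linear \<phi>" "\<And>x. x \<in> Y \<Longrightarrow> \<phi> x = (0::real)"
  shows "(\<lambda>x. if x \<in> V then \<phi> x else 0) \<in> dual_space (transl_topology V \<N>)"
proof -
  note V = zero_nhd_base_subspace[OF base]
  let ?F = "\<lambda>x. if x \<in> V then \<phi> x else 0"
  have "openin (transl_topology V \<N>) {x \<in> V. ?F x \<in> U}" for U
    unfolding openin_transl_topology[OF base]
  proof (intro conjI ballI)
    fix f assume f: "f \<in> {x \<in> V. ?F x \<in> U}"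
    have "f + h \<in> {x \<in> V. ?F x \<in> U}" if "h \<in> W" for h
    proof -
      have "h \<in> V"
        using zero_nhd_base_subset[OF base W(1)] that by (rule subsetD)
      then have "f + h \<in> V"
        using f subspace_add[OF V] by simp
      moreover have "\<phi> (f + h) = \<phi> f"
        using that W(2) \<phi> by (auto simp: linear_add)
      ultimately show ?thesis
        using f by (simp split: if_splits)
    qed
    then show "\<exists>W\<in>\<N>. (\<lambda>h. f + h) ` W \<subseteq> {x \<in> V. ?F x \<in> U}"
      by (intro bexI[OF _ W(1)] image_subsetI)
  qed blast
  then have "continuous_map (transl_topology V \<N>) euclideanreal ?F"
    by (simp add: continuous_map_def topspace_transl_topology[OF base])
  then show ?thesis
    using subspace_add[OF V] subspace_scale[OF V] \<phi>(1)
    by (simp add: dual_space_def topspace_transl_topology[OF base] linear_add linear_scale)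
qed

text \<open>Scaling by \<open>r > 0\<close> maps the neighborhood \<open>Y\<close> of \<open>0\<close> onto itself, so that \<open>E + r Y\<close> is a union
  of finitely many cosets of \<open>Y\<close>.\<close>

lemma tvs_bounded_imp_finite_mod_open_subspace:
  fixes V :: "'v::real_vector set"
  assumes base: "zero_nhd_base V \<N>"
    and W: "W \<in> \<N>" "W \<subseteq> Y"
    and Y: "subspace Y" "Y \<subseteq> V"
    and A: "tvs_bounded (transl_topology V \<N>) A"
  obtains E where "finite E" "E \<subseteq> V" "A \<subseteq> {e + y | e y. e \<in> E \<and> y \<in> Y}"
proof -
  have "0 \<in> V"
    using zero_nhd_base_subspace[OF base] by (rule subspace_0)
  have "(\<lambda>h. 0 + h) ` W \<subseteq> Y"
    using W(2) by auto
  then have nhd: "\<exists>O'. openin (transl_topology V \<N>) O' \<and> 0 \<in> O' \<and> O' \<subseteq> Y"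
    unfolding transl_topology_nhd_iff[OF base \<open>0 \<in> V\<close> Y(2)] using W(1) by (rule bexI)
  have "\<exists>r>0. \<exists>E. finite E \<and> E \<subseteq> V \<and> A \<subseteq> {e + r *\<^sub>R u | e u. e \<in> E \<and> u \<in> Y}"
    using conjunct2[OF A[unfolded tvs_bounded_def topspace_transl_topology[OF base]]] Y(2) nhd
    by simp
  then obtain r E where E: "finite E" "E \<subseteq> V" "A \<subseteq> {e + r *\<^sub>R u | e u. e \<in> E \<and> u \<in> Y}"
    by auto
  have "{e + r *\<^sub>R u | e u. e \<in> E \<and> u \<in> Y} \<subseteq> {e + y | e y. e \<in> E \<and> y \<in> Y}"
  proof clarify
    fix e u assume "e \<in> E" "u \<in> Y"
    then show "\<exists>e' y. e + r *\<^sub>R u = e' + y \<and> e' \<in> E \<and> y \<in> Y"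
      using subspace_scale[OF Y(1)] by (intro exI[of _ e] exI[of _ "r *\<^sub>R u"]) simp
  qed
  with E(3) have "A \<subseteq> {e + y | e y. e \<in> E \<and> y \<in> Y}"
    by (rule order_trans)
  with E(1,2) show thesis
    by (rule that)
qed

text \<open>A basic neighborhood of \<open>0\<close> in the dual restricts a functional vanishing on \<open>Y\<close> only through
  its values at finitely many points. So it contains a whole line of functionals vanishing on \<open>Y\<close>
  and at these points, and the unit ball of a norm contains no line.\<close>

lemma not_normable_tau_ucb:
  fixes V :: "'v::real_vector set"
  assumes base: "zero_nhd_base V \<N>"
    and W: "W \<in> \<N>" "W \<subseteq> Y"
    and Y: "subspace Y" "Y \<subseteq> V"
    and codim: "\<And>E. finite E \<Longrightarrow> E \<subseteq> V \<Longrightarrow> \<not> V \<subseteq> span (Y \<union> E)"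
  shows "\<not> normable (tau_ucb (transl_topology V \<N>))"
proof
  define T where "T = transl_topology V \<N>"
  define D where "D = dual_space T"
  define P where "P = {(\<lambda>F :: 'v \<Rightarrow> real. SUP x\<in>A. ennreal \<bar>F x\<bar>) | A. tvs_bounded T A}"
  assume "normable (tau_ucb (transl_topology V \<N>))"
  moreover have sub: "subspace (topspace T)"
    using zero_nhd_base_subspace[OF base] by (simp add: T_def topspace_transl_topology[OF base])
  ultimately obtain n where n: "norm_on D n"
    and eq: "seminorm_topology D P = seminorm_topology D {\<lambda>x. ennreal (n x)}"
    using topspace_tau_ucb[of T] unfolding normable_def T_def[symmetric] D_def P_def
    by (auto simp: tau_ucb_def)
  have D: "subspace D"
    unfolding D_def by (rule subspace_dual_space[OF sub])
  have n0: "n 0 = 0" and n_add: "n (F + G) \<le> n F + n G" and n_nonneg: "0 \<le> n F"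
    if "F \<in> D" "G \<in> D" for F G
    using n that subspace_0[OF D] unfolding norm_on_def by auto
  have base_n: "zero_nhd_base D {{x \<in> D. \<forall>p\<in>Q. p x < ennreal r} | Q r.
      finite Q \<and> Q \<subseteq> {\<lambda>x. ennreal (n x)} \<and> 0 < r}"
    using n0[OF subspace_0[OF D] subspace_0[OF D]] n_add n_nonneg
    by (intro zero_nhd_base_seminorms[OF D])
      (auto simp flip: ennreal_plus intro: ennreal_leI)
  have base_P: "zero_nhd_base D {{x \<in> D. \<forall>p\<in>Q. p x < ennreal r} | Q r.
      finite Q \<and> Q \<subseteq> P \<and> 0 < r}"
    by (intro zero_nhd_base_seminorms[OF D])
      (auto simp: P_def SUP_abs_0 SUP_abs_add_le simp del: plus_fun_apply zero_fun_apply)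
  define ball where "ball = {F \<in> D. ennreal (n F) < ennreal 1}"
  have ball: "ball \<subseteq> D" "0 \<in> D"
    using subspace_0[OF D] by (auto simp: ball_def)
  have "ball \<in> {{x \<in> D. \<forall>p\<in>Q. p x < ennreal r} | Q r.
      finite Q \<and> Q \<subseteq> {\<lambda>x. ennreal (n x)} \<and> 0 < r}"
    unfolding ball_def
    by (intro CollectI exI[of _ "{\<lambda>x. ennreal (n x)}"] exI[of _ 1]) auto
  moreover have "(\<lambda>h. 0 + h) ` ball \<subseteq> ball"
    by simp
  ultimately have "\<exists>U. openin (seminorm_topology D {\<lambda>x. ennreal (n x)}) U \<and> 0 \<in> U \<and> U \<subseteq> ball"
    unfolding seminorm_topology_def transl_topology_nhd_iff[OF base_n ball(2,1)] by (rule bexI[rotated])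
  then have "\<exists>W\<in>{{x \<in> D. \<forall>p\<in>Q. p x < ennreal r} | Q r. finite Q \<and> Q \<subseteq> P \<and> 0 < r}.
      (\<lambda>h. 0 + h) ` W \<subseteq> ball"
    unfolding eq[symmetric]
    unfolding seminorm_topology_def transl_topology_nhd_iff[OF base_P ball(2,1)] .
  then obtain Q r where Q: "finite Q" "Q \<subseteq> P" "0 < r"
    and Q_ball: "{F \<in> D. \<forall>p\<in>Q. p F < ennreal r} \<subseteq> ball"
    by auto
  have "\<forall>p\<in>Q. \<exists>E. finite E \<and> E \<subseteq> V \<and>
      (\<forall>F::'v \<Rightarrow> real. linear F \<longrightarrow> (\<forall>x\<in>Y \<union> E. F x = 0) \<longrightarrow>
        p (\<lambda>x. if x \<in> V then F x else 0) = 0)"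
  proof
    fix p assume pQ: "p \<in> Q"
    obtain A where A: "tvs_bounded T A" and p: "p = (\<lambda>F. SUP x\<in>A. ennreal \<bar>F x\<bar>)"
      using pQ Q(2) unfolding P_def by blast
    obtain E where E: "finite E" "E \<subseteq> V" "A \<subseteq> {e + y | e y. e \<in> E \<and> y \<in> Y}"
      by (rule tvs_bounded_imp_finite_mod_open_subspace[OF base W Y A[unfolded T_def]])
    have p0: "p (\<lambda>x. if x \<in> V then F x else 0) = 0"
      if "linear F" "\<forall>x\<in>Y \<union> E. F x = 0" for F :: "'v \<Rightarrow> real"
    proof -
      have "F x = 0" if xA: "x \<in> A" for x
      proof -
        obtain e y where "x = e + y" "e \<in> E" "y \<in> Y"
          using E(3) xA by blast
        then show ?thesis
          using \<open>linear F\<close> \<open>\<forall>x\<in>Y \<union> E. F x = 0\<close> by (simp add: linear_add)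
      qed
      then show ?thesis
        unfolding p by (intro antisym SUP_least) auto
    qed
    show "\<exists>E. finite E \<and> E \<subseteq> V \<and>
        (\<forall>F::'v \<Rightarrow> real. linear F \<longrightarrow> (\<forall>x\<in>Y \<union> E. F x = 0) \<longrightarrow>
          p (\<lambda>x. if x \<in> V then F x else 0) = 0)"
      by (intro exI[of _ E] conjI allI impI E(1,2) p0)
  qed
  from bchoice[OF this] obtain E where E: "\<forall>p\<in>Q. finite (E p) \<and> E p \<subseteq> V \<and>
      (\<forall>F::'v \<Rightarrow> real. linear F \<longrightarrow> (\<forall>x\<in>Y \<union> E p. F x = 0) \<longrightarrow>
        p (\<lambda>x. if x \<in> V then F x else 0) = 0)" ..
  obtain g where g: "g \<in> V" "g \<notin> span (Y \<union> \<Union>(E ` Q))"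
    using codim[of "\<Union>(E ` Q)"] Q(1) E by auto
  obtain \<phi> :: "'v \<Rightarrow> real" where \<phi>: "linear \<phi>" "\<And>x. x \<in> span (Y \<union> \<Union>(E ` Q)) \<Longrightarrow> \<phi> x = 0" "\<phi> g = 1"
    by (rule exists_linear_functional_separating_subspace[OF subspace_span g(2)]) blast
  define F where "F = (\<lambda>x. if x \<in> V then \<phi> x else 0)"
  have vanish: "\<phi> x = 0" if "x \<in> Y \<union> \<Union>(E ` Q)" for x
    using that by (intro \<phi>(2) span_base)
  have FD: "F \<in> D"
    unfolding F_def D_def T_def
    by (rule linear_vanishing_on_open_subspace_in_dual[OF base W \<phi>(1)]) (use vanish in blast)
  have line: "\<bar>c\<bar> * n F < 1" for c
  proof -
    have cF: "c *\<^sub>R F = (\<lambda>x. if x \<in> V then c * \<phi> x else 0)"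
      by (auto simp: F_def fun_eq_iff)
    have lin: "linear (\<lambda>x. c * \<phi> x)"
      using linear_compose_scale_right[OF \<phi>(1), of c] by simp
    have "p (c *\<^sub>R F) = 0" if "p \<in> Q" for p
    proof -
      have "\<forall>x\<in>Y \<union> E p. c * \<phi> x = 0"
        using vanish that by auto
      then show ?thesis
        unfolding cF using bspec[OF E that] lin by simp
    qed
    then have "c *\<^sub>R F \<in> ball"
      using Q_ball subspace_scale[OF D FD] Q(3) by force
    then have "n (c *\<^sub>R F) < 1"
      using ennreal_less_iff[of "n (c *\<^sub>R F)" 1] n_nonneg[of "c *\<^sub>R F" 0] ball(2)
      unfolding ball_def by auto
    then show ?thesis
      using n FD unfolding norm_on_def by simp
  qed
  have "F g \<noteq> 0"
    using g(1) \<phi>(3) by (simp add: F_def)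
  then have "F \<noteq> 0"
    by auto
  then have "n F \<noteq> 0"
    using n FD by (simp add: norm_on_def)
  then show False
    using line[of "1 / n F"] n_nonneg[OF FD FD] by simp
qed

section \<open>Functions bounded on a closed set that is not compact\<close>

text \<open>A closed set that is not compact contains an infinite set \<open>D\<close> without limit points. All
  subsets of \<open>D\<close> are closed, so that any function on \<open>D\<close> is continuous, for instance an unbounded
  one, and Tietze's theorem extends it.\<close>

lemma exists_continuous_unbounded_on_closed_noncompact:
  fixes C :: "'a::metric_space set"
  assumes "closed C" "\<not> compact C"
  obtains f :: "'a \<Rightarrow> real" where "continuous_on UNIV f" "\<And>M. \<exists>x\<in>C. M < \<bar>f x\<bar>"
proof -
  obtain D where D: "infinite D" "D \<subseteq> C" "\<And>x. x \<in> C \<Longrightarrow> \<not> x islimpt D"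
    using assms(2) unfolding compact_eq_Bolzano_Weierstrass by blast
  have closed: "closed S" if "S \<subseteq> D" for S
    unfolding closed_limpt
    using that D(2,3) assms(1) by (meson closed_limpt islimpt_subset order_trans)
  obtain s :: "nat \<Rightarrow> 'a" where s: "inj s" "range s \<subseteq> D"
    using D(1) infinite_countable_subset by blast
  define h where "h = (\<lambda>x. real (inv s x))"
  have "continuous_on D h"
    unfolding continuous_on_closed_vimage[OF closed[OF order_refl]] by (auto intro: closed)
  then have "continuous_map (subtopology euclidean D) euclideanreal h"
    by simp
  moreover have "normal_space (euclidean :: 'a topology)"
    by (simp add: metrizable_imp_normal_space metrizable_space_euclidean)
  ultimately obtain f where f: "continuous_map euclidean euclideanreal f" "\<And>x. x \<in> D \<Longrightarrow> f x = h x"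
    using Tietze_extension_realinterval[of euclidean D UNIV h] closed[OF order_refl] by auto
  have "\<exists>x\<in>C. M < \<bar>f x\<bar>" for M
  proof -
    obtain k :: nat where "M < real k"
      using reals_Archimedean2 by blast
    moreover have "f (s k) = real k"
      using f(2)[of "s k"] s by (auto simp: h_def)
    ultimately show ?thesis
      using s(2) D(2) by (intro bexI[of _ "s k"]) auto
  qed
  with f(1) that show thesis
    by simp
qed

definition bounded_functions_on :: "'a::topological_space set \<Rightarrow> ('a \<Rightarrow> real) set"
  where "bounded_functions_on C = {f \<in> C_space. \<exists>M. \<forall>x\<in>C. \<bar>f x\<bar> \<le> M}"

text \<open>Domination by a multiple of a fixed function is the linear condition behind both boundedness
  on \<open>C\<close>, which is the case \<open>w = 1\<close>, and the growth of the functions in a span.\<close>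

lemma subspace_dominated_functions:
  fixes w :: "'a \<Rightarrow> real"
  shows "subspace {f. \<exists>M. \<forall>x\<in>C. \<bar>f x\<bar> \<le> M * w x}"
proof (rule subspaceI; clarsimp)
  show "\<exists>M. \<forall>x\<in>C. 0 \<le> M * w x"
    by (rule exI[of _ 0]) simp
next
  fix f g :: "'a \<Rightarrow> real" and M N :: real
  assume "\<forall>x\<in>C. \<bar>f x\<bar> \<le> M * w x" "\<forall>x\<in>C. \<bar>g x\<bar> \<le> N * w x"
  then have "\<forall>x\<in>C. \<bar>f x + g x\<bar> \<le> (M + N) * w x"
    by (fastforce simp: algebra_simps)
  then show "\<exists>M. \<forall>x\<in>C. \<bar>f x + g x\<bar> \<le> M * w x" ..
next
  fix c :: real and f :: "'a \<Rightarrow> real" and M :: real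
  assume "\<forall>x\<in>C. \<bar>f x\<bar> \<le> M * w x"
  then have "\<forall>x\<in>C. \<bar>c * f x\<bar> \<le> (\<bar>c\<bar> * M) * w x"
    by (simp add: abs_mult mult.assoc mult_left_mono)
  then show "\<exists>M. \<forall>x\<in>C. \<bar>c * f x\<bar> \<le> M * w x" ..
qed

lemma subspace_bounded_functions_on: "subspace (bounded_functions_on C)"
proof -
  have "bounded_functions_on C = C_space \<inter> {f. \<exists>M. \<forall>x\<in>C. \<bar>f x\<bar> \<le> M * 1}"
    by (auto simp: bounded_functions_on_def)
  then show ?thesis
    using subspace_inter[OF subspace_C_space subspace_dominated_functions[of C "\<lambda>_. 1"]] by metis
qed

text \<open>On \<open>C\<close> the weight \<open>1 + (\<Sum>e\<in>E. \<bar>e\<bar>)\<close> dominates, up to a constant factor, everything in the span of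
  \<open>E\<close> and the bounded functions, but not its own product with an unbounded function.\<close>

lemma finite_extension_of_bounded_functions:
  fixes C :: "'a::topological_space set"
  assumes f: "continuous_on UNIV f" "\<And>M. \<exists>x\<in>C. M < \<bar>f x :: real\<bar>"
    and E: "finite E" "E \<subseteq> C_space"
  shows "\<not> C_space \<subseteq> span (bounded_functions_on C \<union> E)"
proof
  define w where "w = (\<lambda>x. 1 + (\<Sum>e\<in>E. \<bar>e x\<bar>))"
  assume sub: "C_space \<subseteq> span (bounded_functions_on C \<union> E)"
  have w1: "1 \<le> w x" for x
    by (simp add: w_def sum_nonneg)
  have "continuous_on UNIV w"
    unfolding w_def using E(2) by (auto simp: C_space_def intro!: continuous_intros)
  then have "(\<lambda>x. f x * w x) \<in> C_space"
    using f(1) by (auto simp: C_space_def intro!: continuous_intros)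
  also note sub
  also have "span (bounded_functions_on C \<union> E) \<subseteq> {h. \<exists>M. \<forall>x\<in>C. \<bar>h x\<bar> \<le> M * w x}"
  proof (rule span_minimal[OF _ subspace_dominated_functions]; intro subsetI CollectI)
    fix h assume "h \<in> bounded_functions_on C \<union> E"
    then show "\<exists>M. \<forall>x\<in>C. \<bar>h x\<bar> \<le> M * w x"
    proof
      assume "h \<in> bounded_functions_on C"
      then obtain M where M: "\<And>x. x \<in> C \<Longrightarrow> \<bar>h x\<bar> \<le> M"
        by (auto simp: bounded_functions_on_def)
      have "\<bar>h x\<bar> \<le> M * w x" if "x \<in> C" for x
        using M[OF that] w1[of x] mult_left_mono[of 1 "w x" M] by linarith
      then show ?thesis
        by blast
    next
      assume "h \<in> E"
      then have "\<bar>h x\<bar> \<le> (\<Sum>e\<in>E. \<bar>e x\<bar>)" for x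
        using member_le_sum[of h E "\<lambda>e. \<bar>e x\<bar>"] E(1) by simp
      then have "\<bar>h x\<bar> \<le> 1 * w x" for x
        by (simp add: w_def add_increasing)
      then show ?thesis
        by blast
    qed
  qed
  finally obtain M where M: "\<And>x. x \<in> C \<Longrightarrow> \<bar>f x * w x\<bar> \<le> M * w x"
    by blast
  obtain x where x: "x \<in> C" "M < \<bar>f x\<bar>"
    using f(2) by blast
  have "\<bar>f x\<bar> * w x \<le> M * w x"
    using M[OF x(1)] w1[of x] by (simp add: abs_mult)
  then show False
    using x(2) w1[of x] by simp
qed

section \<open>Members of the bornology\<close>

lemma bounded_on_if_rho_less:
  assumes "f \<in> C_space" "rho C f < ennreal r"
  shows "f \<in> bounded_functions_on C"
proof -
  have "\<bar>f x\<bar> \<le> r" if "x \<in> C" for x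
  proof -
    have "ennreal \<bar>f x\<bar> < ennreal r"
      using SUP_upper[OF that, of "\<lambda>x. ennreal \<bar>f x\<bar>"] assms(2) by (simp add: rho_def)
    then show ?thesis
      by (simp add: ennreal_less_iff)
  qed
  then show ?thesis
    using assms(1) unfolding bounded_functions_on_def by blast
qed

lemma rho_le_rho_s: "rho C f \<le> rho_s C f"
  unfolding rho_s_eq
  by (intro INF_greatest rho_mono) (auto simp: enlargement_def intro: bexI)

theorem proposition4p5:
  fixes \<B> :: "'a::metric_space set set"
  assumes "bornology \<B>"
    and "has_closed_base \<B>"
    and "normable (tau_ucb (tau_s \<B>)) \<or> normable (tau_ucb (tau \<B>))"
  shows "\<B> \<subseteq> relatively_compact_sets"
proof
  fix B assume B: "B \<in> \<B>"
  obtain C where C: "C \<in> \<B>" "closed C" "B \<subseteq> C"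
    using assms(2) B by (auto simp: has_closed_base_def)
  have "compact C"
  proof (rule ccontr)
    assume "\<not> compact C"
    then obtain f :: "'a \<Rightarrow> real" where f: "continuous_on UNIV f" "\<And>M. \<exists>x\<in>C. M < \<bar>f x\<bar>"
      using exists_continuous_unbounded_on_closed_noncompact[OF C(2)] by blast
    have Y: "bounded_functions_on C \<subseteq> C_space"
      by (auto simp: bounded_functions_on_def)
    note codim = finite_extension_of_bounded_functions[OF f]
    have "{f \<in> C_space. rho C f < ennreal 1} \<subseteq> bounded_functions_on C"
      by (intro subsetI bounded_on_if_rho_less[of _ _ 1]) auto
    then have "\<not> normable (tau_ucb (tau \<B>))"
      unfolding tau_def
      by (intro not_normable_tau_ucb[OF zero_nhd_base_tau[OF assms(1)]
            _ _ subspace_bounded_functions_on Y codim])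
        (auto intro!: exI[of _ C] exI[of _ 1] C(1))
    moreover have "{f \<in> C_space. rho_s C f < ennreal 1} \<subseteq> bounded_functions_on C"
      by (intro subsetI bounded_on_if_rho_less[of _ _ 1])
        (auto intro: order.strict_trans1[OF rho_le_rho_s])
    then have "\<not> normable (tau_ucb (tau_s \<B>))"
      unfolding tau_s_def
      by (intro not_normable_tau_ucb[OF zero_nhd_base_tau_s[OF assms(1)]
            _ _ subspace_bounded_functions_on Y codim])
        (auto intro!: exI[of _ C] exI[of _ 1] C(1))
    ultimately show False
      using assms(3) by blast
  qed
  then have "compact (closure B)"
    using closure_minimal[OF C(3,2)] by (metis closed_closure compact_Int_closed inf.absorb_iff2)
  moreover have "B \<noteq> {}"
    using B assms(1) by (auto simp: bornology_def)
  ultimately show "B \<in> relatively_compact_sets"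
    by (simp add: relatively_compact_sets_def)
qed

end
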